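(* Let $\kappa\in\mathbb{R}$ and consider the Camassa-Holm-Kadomtsev-Petviashvili equation $$Lu_t+\kappa u_{xx}+(3uu_x-2u_xu_{xx}-uu_{xxx})_x+u_{yy}=0,\qquad Lf:=\partial_x(1-\partial_x^2)f,$$ for real-valued $u=u(t,x,y)$, $(t,x,y)\in I\times\mathbb{R}^2$. Assume that this equation has a unique classical solution $u(t,x,y)$, $(t,x,y)\in I\times\mathbb{R}^2$, for the given initial data $u_0(x,y)=u(0,x,y)$. If $u$ is $x$-symmetric with axis of symmetry $\lambda=\lambda(t)$, then $u$ is a steady solution in the $x$-direction with speed $\dot\lambda(0)$; that is, there exists a function $g$ such that $u(t,x,y)=g(x-\dot\lambda(0)t,\,y)$ for all $(t,x,y)\in I\times\mathbb{R}^2$.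
   Context: $I=[0,T]$ with $T>0$ is an interval of existence of the equation. A classical solution is a function on $I\times\mathbb{R}^2$ for which all partial derivatives occurring in the equation exist and are continuous and which satisfies the equation pointwise. A function $f(t,x,y)$, $(t,x,y)\in I\times\mathbb{R}^2$, is called $x$-symmetric if there exists a function $\lambda\in C^1(\mathbb{R})$ such that $f(t,x,y)=f(t,2\lambda(t)-x,y)$ for all $(t,x,y)\in I\times\mathbb{R}^2$; $\lambda$ is called the axis of symmetry, and $\dot\lambda$ denotes its derivative. A function $f(t,x,y)$ is called steady in the $x$-direction (with speed $c\in\mathbb{R}$) if there exists a function $g$ such that $f(t,x,y)=g(x-ct,y)$ for all $(t,x,y)\in I\times\mathbb{R}^2$. *)

theory Defs
  imports "HOL-Analysis.Analysis"
begin

(* Functions on I \<times> R^2 are total curried functions of (t, x, y); only their values for t in I matter.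
   Time derivatives are taken within I, hence are one-sided at the end points of I. *)
type_synonym field3 = "real \<Rightarrow> real \<Rightarrow> real \<Rightarrow> real"

definition dt :: "real set \<Rightarrow> field3 \<Rightarrow> field3" where
  "dt I f = (\<lambda>t x y. vector_derivative (\<lambda>s. f s x y) (at t within I))"

definition dx :: "field3 \<Rightarrow> field3" where
  "dx f = (\<lambda>t x y. deriv (\<lambda>z. f t z y) x)"

definition dy :: "field3 \<Rightarrow> field3" where
  "dy f = (\<lambda>t x y. deriv (\<lambda>z. f t x z) y)"

definition continuous_field :: "real set \<Rightarrow> field3 \<Rightarrow> bool" where
  "continuous_field I f \<longleftrightarrow> continuous_on (I \<times> UNIV \<times> UNIV) (\<lambda>(t, x, y). f t x y)"

(* deriv and vector_derivative return an arbitrary value where no derivative exists, so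
   existence is required separately. *)
definition has_cont_dt :: "real set \<Rightarrow> field3 \<Rightarrow> bool" where
  "has_cont_dt I f \<longleftrightarrow>
     (\<forall>t\<in>I. \<forall>x y. (\<lambda>s. f s x y) differentiable (at t within I)) \<and> continuous_field I (dt I f)"

definition has_cont_dx :: "real set \<Rightarrow> field3 \<Rightarrow> bool" where
  "has_cont_dx I f \<longleftrightarrow>
     (\<forall>t\<in>I. \<forall>x y. (\<lambda>z. f t z y) differentiable (at x)) \<and> continuous_field I (dx f)"

definition has_cont_dy :: "real set \<Rightarrow> field3 \<Rightarrow> bool" where
  "has_cont_dy I f \<longleftrightarrow>
     (\<forall>t\<in>I. \<forall>x y. (\<lambda>z. f t x z) differentiable (at y)) \<and> continuous_field I (dy f)"

definition L_op :: "field3 \<Rightarrow> field3" where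
  "L_op f = dx (\<lambda>t x y. f t x y - dx (dx f) t x y)"

(* The regularity clauses list u_t, u_tx, u_txx, u_txxx, then u_x, u_xx, u_xxx, u_xxxx, then u_y, u_yy. *)
definition CHKP_classical_solution :: "real \<Rightarrow> real set \<Rightarrow> field3 \<Rightarrow> bool" where
  "CHKP_classical_solution \<kappa> I u \<longleftrightarrow>
     has_cont_dt I u \<and> has_cont_dx I (dt I u) \<and> has_cont_dx I (dx (dt I u)) \<and>
     has_cont_dx I (dx (dx (dt I u))) \<and>
     has_cont_dx I u \<and> has_cont_dx I (dx u) \<and> has_cont_dx I (dx (dx u)) \<and>
     has_cont_dx I (dx (dx (dx u))) \<and>
     has_cont_dy I u \<and> has_cont_dy I (dy u) \<and>
     (\<forall>t\<in>I. \<forall>x y.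
        L_op (dt I u) t x y + \<kappa> * dx (dx u) t x y
        + dx (\<lambda>t x y. 3 * u t x y * dx u t x y - 2 * dx u t x y * dx (dx u) t x y
                      - u t x y * dx (dx (dx u)) t x y) t x y
        + dy (dy u) t x y = 0)"

definition CHKP_unique_classical_solution ::
    "real \<Rightarrow> real set \<Rightarrow> (real \<Rightarrow> real \<Rightarrow> real) \<Rightarrow> field3 \<Rightarrow> bool" where
  "CHKP_unique_classical_solution \<kappa> I u0 u \<longleftrightarrow>
     CHKP_classical_solution \<kappa> I u \<and> (\<forall>x y. u 0 x y = u0 x y) \<and>
     (\<forall>v. CHKP_classical_solution \<kappa> I v \<and> (\<forall>x y. v 0 x y = u0 x y) \<longrightarrow>
          (\<forall>t\<in>I. \<forall>x y. v t x y = u t x y))"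

definition x_symmetric_with_axis :: "real set \<Rightarrow> field3 \<Rightarrow> (real \<Rightarrow> real) \<Rightarrow> bool" where
  "x_symmetric_with_axis I f lam \<longleftrightarrow>
     lam C1_differentiable_on UNIV \<and> (\<forall>t\<in>I. \<forall>x y. f t x y = f t (2 * lam t - x) y)"

definition steady_in_x :: "real set \<Rightarrow> field3 \<Rightarrow> real \<Rightarrow> bool" where
  "steady_in_x I f c \<longleftrightarrow>
     (\<exists>g :: real \<Rightarrow> real \<Rightarrow> real. \<forall>t\<in>I. \<forall>x y. f t x y = g (x - c * t) y)"

end

theory Submission imports Defs begin

text \<open>
  Fix a time \<open>t\<close>, and let \<open>a\<close> be the axis and \<open>c\<close> its speed at that time. Differentiating
  \<open>u(t, x, y) = u(t, 2 \<lambda>(t) - x, y)\<close> in \<open>t\<close> and using that \<open>u\<^sub>x\<close> is odd about \<open>a\<close> shows that the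
  transport defect \<open>q = u\<^sub>t + c u\<^sub>x\<close> is even in \<open>x\<close> about \<open>a\<close> (\<open>transport_defect_symmetric\<close>).

  Now compare parities in the equation. The operator \<open>L\<close> has only \<open>x\<close>-derivatives of odd order, so
  it exchanges even and odd functions; hence \<open>L q\<close> is odd. All terms other than \<open>L u\<^sub>t\<close> are even,
  because \<open>u\<close> is even and the flux inside the outer \<open>x\<close>-derivative is odd
  (\<open>mirrored_spatial_terms\<close>). The equation makes \<open>L q\<close> equal to \<open>c L u\<^sub>x\<close> minus these terms, which is
  even. Being both even and odd, \<open>L q\<close> vanishes: at every time,
  \<open>L u\<^sub>t = - c L u\<^sub>x\<close> (\<open>L_op_dt_eq_neg_speed_L_op_dx\<close>).

  At \<open>t = 0\<close> this turns the equation into the steady-wave equation for the initial profile with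
  speed \<open>c = \<lambda>'(0)\<close>. Therefore \<open>v(t, x, y) = u(0, x - c t, y)\<close> is a classical solution
  (\<open>classical_solution_travelling\<close>), and it has the same initial data as \<open>u\<close>. By uniqueness
  \<open>u = v\<close>, so the profile \<open>u(0, \<cdot>, \<cdot>)\<close> is the required function \<open>g\<close>.
\<close>

section \<open>Fields on a single time slice\<close>

text \<open>
  The \<open>x\<close>-derivatives at a time \<open>t\<close> depend only on the function \<open>f t\<close>. The equations below are
  therefore stated for \<open>f t\<close>, so that they still apply to fields, such as \<open>dt I u\<close>, about which
  nothing is known outside the time interval.
\<close>

definition x_differentiable :: "field3 \<Rightarrow> real \<Rightarrow> bool" where
  "x_differentiable f t \<longleftrightarrow> (\<forall>x y. (\<lambda>z. f t z y) differentiable (at x))"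

lemma has_cont_dx_imp_x_differentiable:
  "has_cont_dx I f \<Longrightarrow> t \<in> I \<Longrightarrow> x_differentiable f t"
  by (simp add: has_cont_dx_def x_differentiable_def)

lemma x_differentiable_imp_DERIV:
  "x_differentiable f t \<Longrightarrow> ((\<lambda>z. f t z y) has_field_derivative dx f t x y) (at x)"
  by (simp add: x_differentiable_def dx_def DERIV_deriv_iff_real_differentiable)

lemma dx_eqI:
  "((\<lambda>z. f t z y) has_field_derivative D) (at x) \<Longrightarrow> dx f t x y = D"
  by (simp add: dx_def DERIV_imp_deriv)

lemma dx_slice_cong: "f t = g t \<Longrightarrow> dx f t = dx g t"
  by (simp add: dx_def)

lemma x_differentiable_slice_cong: "f t = g t \<Longrightarrow> x_differentiable f t = x_differentiable g t"
  by (simp add: x_differentiable_def)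

lemma x_differentiable_add_scaled:
  assumes "x_differentiable f t" "x_differentiable g t"
  shows "x_differentiable (\<lambda>t x y. f t x y + c * g t x y) t"
  using assms unfolding x_differentiable_def by (auto intro!: derivative_intros)

lemma dx_add_scaled:
  assumes "x_differentiable f t" "x_differentiable g t"
  shows "dx (\<lambda>t x y. f t x y + c * g t x y) t = (\<lambda>t x y. dx f t x y + c * dx g t x y) t"
  by (intro ext dx_eqI) (auto intro!: derivative_eq_intros x_differentiable_imp_DERIV assms)

definition x_differentiable3 :: "field3 \<Rightarrow> real \<Rightarrow> bool" where
  "x_differentiable3 f t \<longleftrightarrow>
     x_differentiable f t \<and> x_differentiable (dx f) t \<and> x_differentiable (dx (dx f)) t"

lemma L_op_eq:
  assumes "x_differentiable3 f t"
  shows "L_op f t x y = dx f t x y - dx (dx (dx f)) t x y"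
  unfolding L_op_def using assms
  by (intro dx_eqI derivative_intros x_differentiable_imp_DERIV) (auto simp: x_differentiable3_def)

lemma L_op_slice_cong: "f t = g t \<Longrightarrow> L_op f t = L_op g t"
  unfolding L_op_def by (intro dx_slice_cong) (metis dx_slice_cong)

lemma add_scaled_derivatives:
  assumes "x_differentiable3 f t" "x_differentiable3 g t"
  shows "x_differentiable3 (\<lambda>t x y. f t x y + c * g t x y) t"
    and "dx (dx (dx (\<lambda>t x y. f t x y + c * g t x y))) t
         = (\<lambda>t x y. dx (dx (dx f)) t x y + c * dx (dx (dx g)) t x y) t"
proof -
  let ?h = "\<lambda>(f::field3) (g::field3). (\<lambda>t x y. f t x y + c * g t x y)"
  have 1: "dx (?h f g) t = ?h (dx f) (dx g) t"
    using assms by (intro dx_add_scaled) (auto simp: x_differentiable3_def)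
  have 2: "dx (dx (?h f g)) t = ?h (dx (dx f)) (dx (dx g)) t"
    using assms by (subst dx_slice_cong[where f = "dx (?h f g)" and g = "?h (dx f) (dx g)" and t = t, OF 1], intro dx_add_scaled)
      (auto simp: x_differentiable3_def)
  show "dx (dx (dx (?h f g))) t = ?h (dx (dx (dx f))) (dx (dx (dx g))) t"
    using assms by (subst dx_slice_cong[where f = "dx (dx (?h f g))" and g = "?h (dx (dx f)) (dx (dx g))" and t = t, OF 2], intro dx_add_scaled)
      (auto simp: x_differentiable3_def)
  show "x_differentiable3 (?h f g) t"
    using assms unfolding x_differentiable3_def
      x_differentiable_slice_cong[where f = "dx (?h f g)" and g = "?h (dx f) (dx g)" and t = t, OF 1]
      x_differentiable_slice_cong[where f = "dx (dx (?h f g))" and g = "?h (dx (dx f)) (dx (dx g))" and t = t, OF 2]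
    by (simp add: x_differentiable_add_scaled)
qed

lemma L_op_add_scaled:
  assumes "x_differentiable3 f t" "x_differentiable3 g t"
  shows "L_op (\<lambda>t x y. f t x y + c * g t x y) t x y = L_op f t x y + c * L_op g t x y"
proof -
  have "dx (\<lambda>t x y. f t x y + c * g t x y) t = (\<lambda>t x y. dx f t x y + c * dx g t x y) t"
    using assms by (intro dx_add_scaled) (auto simp: x_differentiable3_def)
  then show ?thesis
    using assms add_scaled_derivatives[OF assms, of c] by (simp add: L_op_eq algebra_simps)
qed

text \<open>The case \<open>f = 0\<close> of the preceding lemma.\<close>

lemma L_op_scaled:
  assumes "x_differentiable3 g t"
  shows "L_op (\<lambda>t x y. c * g t x y) t x y = c * L_op g t x y"
proof -
  have z: "dx (\<lambda>t x y. 0) = (\<lambda>t x y. 0)"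
    by (simp add: dx_def)
  have "x_differentiable3 (\<lambda>t x y. 0) t"
    by (simp add: x_differentiable3_def z) (simp add: x_differentiable_def)
  from L_op_add_scaled[OF this assms, of c x y] show ?thesis
    by (simp add: L_op_def z)
qed

section \<open>Parity under reflection\<close>

text \<open>
  The sign \<open>s = 1\<close> means even about \<open>a\<close> in the first variable, \<open>s = - 1\<close> means odd.
\<close>

definition mirrored :: "real \<Rightarrow> real \<Rightarrow> (real \<Rightarrow> real \<Rightarrow> real) \<Rightarrow> bool" where
  "mirrored a s h \<longleftrightarrow> (\<forall>x y. h (2 * a - x) y = s * h x y)"

lemma mirrored_dx:
  assumes "mirrored a s (f t)" "x_differentiable f t"
  shows "mirrored a (- s) (dx f t)"
  unfolding mirrored_def
proof (intro allI dx_eqI)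
  fix x y
  \<comment> \<open>Chain rule at the reflected point, which the reflection maps back to \<open>x\<close>; the factor
    \<open>0 - 1\<close> is the derivative of the reflection.\<close>
  have "((\<lambda>z. s * f t (2 * a - z) y) has_field_derivative
          s * (dx f t (2 * a - (2 * a - x)) y * (0 - 1))) (at (2 * a - x))"
    by (intro DERIV_cmult DERIV_chain2[OF x_differentiable_imp_DERIV[OF assms(2)]]
        derivative_intros)
  moreover have "s * f t (2 * a - z) y = f t z y" for z
    using assms(1)[unfolded mirrored_def, rule_format, of "2 * a - z" y] by simp
  ultimately show "((\<lambda>z. f t z y) has_field_derivative - s * dx f t x y) (at (2 * a - x))"
    by simp
qed

lemma mirrored_dy:
  assumes "mirrored a 1 (f t)"
  shows "mirrored a 1 (dy f t)"
  proof -
  have "f t (2 * a - x) = f t x" for x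
    using assms by (auto simp: mirrored_def)
  then show ?thesis
    by (simp add: mirrored_def dy_def)
qed

lemma mirrored_L_op:
  assumes "mirrored a s (f t)" "x_differentiable3 f t"
  shows "mirrored a (- s) (L_op f t)"
proof -
  have 1: "mirrored a (- s) (dx f t)"
    using assms by (intro mirrored_dx) (auto simp: x_differentiable3_def)
  have "mirrored a s (dx (dx f) t)"
    using mirrored_dx[of a "- s" "dx f" t] 1 assms by (auto simp: x_differentiable3_def)
  then have "mirrored a (- s) (dx (dx (dx f)) t)"
    using assms by (intro mirrored_dx) (auto simp: x_differentiable3_def)
  with 1 show ?thesis
    using assms(2) by (simp add: mirrored_def L_op_eq algebra_simps)
qed

section \<open>The transport defect of a symmetric solution\<close>

text \<open>
  A chain rule along a moving point \<open>(s, p s)\<close>. The time set \<open>I\<close> may be an interval with \<open>t\<close> at its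
  end, so the derivative in \<open>t\<close> is taken within \<open>I\<close>, and total differentiability of \<open>f\<close> within
  \<open>I \<times> \<real>\<close> comes from the existence of \<open>f\<^sub>t\<close> at the single point \<open>(t, p t)\<close> together with
  continuity of \<open>f\<^sub>x\<close>.
\<close>

lemma has_vector_derivative_along_x_curve:
  fixes f :: field3
  assumes diff_t: "(\<lambda>s. f s (p t) y) differentiable (at t within I)"
    and dx: "has_cont_dx I f"
    and p: "(p has_vector_derivative p') (at t within I)"
    and t: "t \<in> I"
  shows "((\<lambda>s. f s (p s) y) has_vector_derivative dt I f t (p t) y + p' * dx f t (p t) y)
           (at t within I)"
proof -
  let ?F = "\<lambda>s z. blinfun_mult_right (dx f s z y) :: real \<Rightarrow>\<^sub>L real"
  have cont: "continuous_on (I \<times> UNIV) (\<lambda>(s, z). dx f s z y)"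
  proof -
    have "continuous_on (I \<times> UNIV \<times> UNIV) (\<lambda>(s, z, y). dx f s z y)"
      using dx by (simp add: has_cont_dx_def continuous_field_def)
    then have "continuous_on (I \<times> UNIV) (\<lambda>w. (\<lambda>(s, z, y). dx f s z y) (fst w, snd w, y))"
      by (rule continuous_on_compose2) (auto intro!: continuous_intros)
    then show ?thesis by (simp add: case_prod_beta)
  qed
  have "((\<lambda>(s, z). f s z y) has_derivative
          (\<lambda>(ts, tz). ts *\<^sub>R dt I f t (p t) y + blinfun_apply (?F t (p t)) tz))
          (at (t, p t) within I \<times> UNIV)"
  proof (rule has_derivative_partialsI)
    show "((\<lambda>s. f s (p t) y) has_derivative (\<lambda>h. h *\<^sub>R dt I f t (p t) y)) (at t within I)"
      using diff_t unfolding dt_def vector_derivative_works has_vector_derivative_def .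
    show "((\<lambda>z. f s z y) has_derivative blinfun_apply (?F s z)) (at z within UNIV)"
      if "s \<in> I" for s z
      using x_differentiable_imp_DERIV[OF has_cont_dx_imp_x_differentiable[OF dx that], of y z]
      by (simp add: has_field_derivative_def)
    show "continuous (at (t, p t) within I \<times> UNIV) (\<lambda>(s, z). ?F s z)"
    proof -
      have "continuous_on (I \<times> UNIV) (\<lambda>w. blinfun_mult_right ((\<lambda>(s, z). dx f s z y) w) :: real \<Rightarrow>\<^sub>L real)"
        by (intro bounded_linear.continuous_on[OF bounded_linear_blinfun_mult_right] cont)
      then have "continuous_on (I \<times> UNIV) (\<lambda>(s, z). ?F s z)"
        by (simp add: case_prod_beta)
      then show ?thesis
        using t by (simp only: continuous_on_eq_continuous_within) auto
    qed
  qed auto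
  then have D: "((\<lambda>(s, z). f s z y) has_derivative
          (\<lambda>(ts, tz). ts *\<^sub>R dt I f t (p t) y + blinfun_apply (?F t (p t)) tz))
          (at (t, p t) within (\<lambda>s. (s, p s)) ` I)"
    by (rule has_derivative_subset) auto
  have P: "((\<lambda>s. (s, p s)) has_derivative (\<lambda>h. (h, h *\<^sub>R p'))) (at t within I)"
    using p by (intro derivative_intros) (simp add: has_vector_derivative_def)
  show ?thesis
    using has_derivative_in_compose[OF P D]
    by (simp add: has_vector_derivative_def algebra_simps)
qed

text \<open>
  Differentiating the symmetry in time gives \<open>u\<^sub>t(x) = u\<^sub>t(2a - x) + 2c u\<^sub>x(2a - x)\<close>. Half of the
  additional term can be moved to the left because \<open>u\<^sub>x(2a - x) = - u\<^sub>x(x)\<close>.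
\<close>

lemma transport_defect_symmetric:
  assumes T: "T > 0" and t: "t \<in> {0..T}"
    and ut: "has_cont_dt {0..T} u" and ux: "has_cont_dx {0..T} u"
    and sym: "x_symmetric_with_axis {0..T} u lam"
  shows "mirrored (lam t) 1 (\<lambda>x y. dt {0..T} u t x y + deriv lam t * dx u t x y)"
proof -
  let ?I = "{0..T}"
  let ?a = "lam t" and ?c = "deriv lam t"
  have reflect: "u s (2 * lam s - x) y = u s x y" if "s \<in> ?I" for s x y
    using sym that unfolding x_symmetric_with_axis_def by metis
  have "lam differentiable at t"
    using sym by (auto simp: x_symmetric_with_axis_def C1_differentiable_on_eq)
  then have "(lam has_field_derivative ?c) (at t)"
    by (simp add: DERIV_deriv_iff_real_differentiable)
  then have lam': "(lam has_vector_derivative ?c) (at t within ?I)"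
    by (simp add: has_real_derivative_iff_has_vector_derivative has_vector_derivative_at_within)
  have main: "dt ?I u t x y = dt ?I u t (2 * ?a - x) y + 2 * ?c * dx u t (2 * ?a - x) y" for x y
  proof -
    have "((\<lambda>s. u s (2 * lam s - x) y) has_vector_derivative
            dt ?I u t (2 * ?a - x) y + 2 * ?c * dx u t (2 * ?a - x) y) (at t within ?I)"
    proof (rule has_vector_derivative_along_x_curve[OF _ ux _ t])
      show "(\<lambda>s. u s (2 * ?a - x) y) differentiable at t within ?I"
        using ut t by (simp add: has_cont_dt_def)
      show "((\<lambda>s. 2 * lam s - x) has_vector_derivative 2 * ?c) (at t within ?I)"
        using lam' by (auto intro!: derivative_eq_intros)
    qed
    then have "((\<lambda>s. u s x y) has_vector_derivative
            dt ?I u t (2 * ?a - x) y + 2 * ?c * dx u t (2 * ?a - x) y) (at t within ?I)"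
      by (rule has_vector_derivative_transform[OF t, rotated]) (simp add: reflect)
    then show ?thesis
      unfolding dt_def using T t by (intro vector_derivative_within_closed_interval)
  qed
  have "mirrored ?a (- 1) (dx u t)"
    using t by (intro mirrored_dx has_cont_dx_imp_x_differentiable[OF ux])
      (simp_all add: mirrored_def reflect)
  then have odd: "dx u t (2 * ?a - x) y = - dx u t x y" for x y
    by (simp add: mirrored_def)
  show ?thesis
    unfolding mirrored_def
  proof (intro allI)
    fix x y
    show "dt ?I u t (2 * ?a - x) y + ?c * dx u t (2 * ?a - x) y =
            1 * (dt ?I u t x y + ?c * dx u t x y)"
      using main[of x y] odd[of x y] by simp
  qed
qed

lemma classical_solutionD:
  assumes "CHKP_classical_solution \<kappa> I u" "t \<in> I"
  shows "x_differentiable3 (dt I u) t" "x_differentiable3 (dx u) t"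
    and "x_differentiable u t" "x_differentiable (dx (dx (dx u))) t"
  using assms(1) has_cont_dx_imp_x_differentiable[OF _ assms(2)]
  unfolding CHKP_classical_solution_def x_differentiable3_def by blast+

text \<open>
  Named so that its parity and its behaviour under translation can be stated on their own; its
  \<open>x\<close>-derivative is the nonlinear part of the equation.
\<close>

definition CHKP_flux :: "field3 \<Rightarrow> field3" where
  "CHKP_flux u = (\<lambda>t x y. 3 * u t x y * dx u t x y - 2 * dx u t x y * dx (dx u) t x y
                      - u t x y * dx (dx (dx u)) t x y)"

text \<open>
  Each product in the flux has an odd number of \<open>x\<close>-derivatives in total, so the flux of an even
  function is odd and its \<open>x\<close>-derivative is even again.
\<close>

lemma mirrored_spatial_terms:
  assumes sol: "CHKP_classical_solution \<kappa> I u" and t: "t \<in> I" and u: "mirrored a 1 (u t)"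
  shows "mirrored a 1 (\<lambda>x y. \<kappa> * dx (dx u) t x y + dx (CHKP_flux u) t x y + dy (dy u) t x y)"
proof -
  note d = classical_solutionD[OF sol t, unfolded x_differentiable3_def]
  have 1: "mirrored a (- 1) (dx u t)"
    using mirrored_dx[of a 1 u t] u d by simp
  have 2: "mirrored a 1 (dx (dx u) t)"
    using mirrored_dx[of a "- 1" "dx u" t] 1 d by simp
  have 3: "mirrored a (- 1) (dx (dx (dx u)) t)"
    using mirrored_dx[of a 1 "dx (dx u)" t] 2 d by simp
  have "mirrored a (- 1) (CHKP_flux u t)"
    using u 1 2 3 by (simp add: mirrored_def CHKP_flux_def algebra_simps)
  moreover have "x_differentiable (CHKP_flux u) t"
    using d unfolding CHKP_flux_def x_differentiable_def by (auto intro!: derivative_intros)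
  ultimately have "mirrored a 1 (dx (CHKP_flux u) t)"
    using mirrored_dx[of a "- 1" "CHKP_flux u" t] by simp
  moreover have "mirrored a 1 (dy (dy u) t)"
    using u by (intro mirrored_dy)
  ultimately show ?thesis
    using 2 by (simp add: mirrored_def)
qed

text \<open>
  \<open>L\<close> of the transport defect is odd because the defect is even, and even because the equation
  expresses it by even terms; so it is zero.
\<close>

lemma L_op_dt_eq_neg_speed_L_op_dx:
  assumes T: "T > 0" and t: "t \<in> {0..T}"
    and sol: "CHKP_classical_solution \<kappa> {0..T} u"
    and sym: "x_symmetric_with_axis {0..T} u lam"
  shows "L_op (dt {0..T} u) t x y = - deriv lam t * L_op (dx u) t x y"
proof -
  let ?I = "{0..T}"
  let ?a = "lam t" and ?c = "deriv lam t"
  \<comment> \<open>\<open>?c\<close> is the speed at the chosen time, a constant also where the bound \<open>t\<close> of \<open>?q\<close> varies.\<close>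
  let ?q = "\<lambda>t x y. dt ?I u t x y + ?c * dx u t x y"
  let ?E = "\<lambda>x y. \<kappa> * dx (dx u) t x y + dx (CHKP_flux u) t x y + dy (dy u) t x y"
  note d = classical_solutionD[OF sol t]
  have u: "mirrored ?a 1 (u t)"
    using sym t unfolding mirrored_def x_symmetric_with_axis_def by (metis mult_1)
  have "mirrored ?a (- 1) (dx u t)"
    using u d by (intro mirrored_dx)
  then have even: "mirrored ?a 1 (L_op (dx u) t)"
    using mirrored_L_op[of ?a "- 1" "dx u" t] d by simp
  have "mirrored ?a 1 (?q t)"
    using sol by (intro transport_defect_symmetric[OF T t _ _ sym])
      (simp_all only: CHKP_classical_solution_def)
  then have odd: "mirrored ?a (- 1) (L_op ?q t)"
    using add_scaled_derivatives(1)[OF d(1,2)] by (intro mirrored_L_op)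
  have E: "mirrored ?a 1 ?E"
    by (rule mirrored_spatial_terms[OF sol t u])
  have pde: "L_op (dt ?I u) t x y = - ?E x y" for x y
  proof -
    have "L_op (dt ?I u) t x y + \<kappa> * dx (dx u) t x y + dx (CHKP_flux u) t x y
        + dy (dy u) t x y = 0"
      using sol t unfolding CHKP_classical_solution_def CHKP_flux_def by blast
    then show ?thesis by linarith
  qed
  have q: "L_op ?q t x y = L_op (dt ?I u) t x y + ?c * L_op (dx u) t x y" for x y
    by (intro L_op_add_scaled d)
  have "L_op ?q t (2 * ?a - x) y = L_op ?q t x y"
    using even E unfolding q pde by (simp add: mirrored_def)
  moreover have "L_op ?q t (2 * ?a - x) y = - L_op ?q t x y"
    using odd by (simp add: mirrored_def)
  ultimately show ?thesis
    using q[of x y] by simp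
qed

section \<open>Travelling waves\<close>

text \<open>
  Taking a field and not a profile as argument makes \<open>travelling c\<close> an operator on fields that
  commutes with \<open>dx\<close>, \<open>dy\<close>, \<open>L_op\<close> and the flux. The spatial side of the equation for the wave is
  then a translate of the equation for \<open>u\<close> at time \<open>0\<close>.
\<close>

definition travelling :: "real \<Rightarrow> field3 \<Rightarrow> field3" where
  "travelling c f = (\<lambda>t x y. f 0 (x - c * t) y)"

lemma dx_travelling: "dx (travelling c f) = travelling c (dx f)"
proof (intro ext)
  fix t x y
  have "DERIV (\<lambda>z. f 0 (z - c * t) y) x :> D \<longleftrightarrow> DERIV (\<lambda>z. f 0 z y) (x - c * t) :> D" for D
    using DERIV_shift[of "\<lambda>z. f 0 z y" D x "- (c * t)"] by simp
  then show "dx (travelling c f) t x y = travelling c (dx f) t x y"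
    by (simp add: dx_def travelling_def deriv_def)
qed

lemma dy_travelling: "dy (travelling c f) = travelling c (dy f)"
  by (simp add: dy_def travelling_def)

lemma L_op_travelling: "L_op (travelling c f) = travelling c (L_op f)"
proof -
  have "(\<lambda>t x y. travelling c f t x y - travelling c (dx (dx f)) t x y)
      = travelling c (\<lambda>t x y. f t x y - dx (dx f) t x y)"
    by (simp add: travelling_def)
  then show ?thesis
    unfolding L_op_def by (simp only: dx_travelling)
qed

lemma CHKP_flux_travelling: "CHKP_flux (travelling c f) = travelling c (CHKP_flux f)"
  unfolding CHKP_flux_def dx_travelling by (simp add: travelling_def)

lemma continuous_field_travelling:
  assumes "continuous_field I f" "0 \<in> I"
  shows "continuous_field J (travelling c f)"
proof -
  have "continuous_on (J \<times> UNIV \<times> UNIV)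
          (\<lambda>p. (\<lambda>(t, x, y). f t x y) (0, fst (snd p) - c * fst p, snd (snd p)))"
    using assms unfolding continuous_field_def
    by (elim continuous_on_compose2) (auto intro!: continuous_intros)
  then show ?thesis
    by (simp add: continuous_field_def travelling_def case_prod_beta)
qed

lemma has_cont_dx_travelling:
  assumes "has_cont_dx I f" "0 \<in> I"
  shows "has_cont_dx J (travelling c f)"
proof -
  have "(\<lambda>z. travelling c f t z y) differentiable (at x)" for t x y
    unfolding travelling_def real_differentiable_def
    using DERIV_shift[of "\<lambda>z. f 0 z y" _ x "- (c * t)"]
      x_differentiable_imp_DERIV[OF has_cont_dx_imp_x_differentiable[OF assms]] by auto
  then show ?thesis
    using continuous_field_travelling[OF _ assms(2), of "dx f" J c] assms(1)
    by (simp add: has_cont_dx_def dx_travelling)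
qed

lemma has_cont_dy_travelling:
  assumes "has_cont_dy I f" "0 \<in> I"
  shows "has_cont_dy J (travelling c f)"
proof -
  have "(\<lambda>z. travelling c f t x z) differentiable (at y)" for t x y
    using assms by (simp add: has_cont_dy_def travelling_def)
  then show ?thesis
    using continuous_field_travelling[OF _ assms(2), of "dy f" J c] assms(1)
    by (simp add: has_cont_dy_def dy_travelling)
qed

lemma has_vector_derivative_travelling:
  assumes "x_differentiable f 0"
  shows "((\<lambda>s. travelling c f s x y) has_vector_derivative - c * travelling c (dx f) t x y)
           (at t within I)"
proof -
  have "((\<lambda>s. f 0 (x - c * s) y) has_field_derivative dx f 0 (x - c * t) y * (0 - c * 1))
          (at t within I)"
  proof (rule DERIV_chain2[where f = "\<lambda>z. f 0 z y"])
    show "DERIV (\<lambda>z. f 0 z y) (x - c * t) :> dx f 0 (x - c * t) y"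
      by (rule x_differentiable_imp_DERIV[OF assms])
    show "((\<lambda>s. x - c * s) has_field_derivative (0 - c * 1)) (at t within I)"
      by (auto intro!: derivative_eq_intros)
  qed
  then show ?thesis
    by (simp add: travelling_def has_real_derivative_iff_has_vector_derivative mult.commute)
qed

text \<open>
  The time derivative of a travelling wave is known only for times in the interval. The next lemmas
  carry regularity over from the explicit field \<open>- c u\<^sub>x(0, x - c t, y)\<close>.
\<close>

lemma continuous_field_slice_cong:
  assumes "\<And>t. t \<in> I \<Longrightarrow> f t = g t"
  shows "continuous_field I f = continuous_field I g"
  unfolding continuous_field_def by (intro continuous_on_cong) (auto simp: assms)

lemma has_cont_dx_slice_cong:
  assumes "\<And>t. t \<in> I \<Longrightarrow> f t = g t"
  shows "has_cont_dx I f = has_cont_dx I g"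
  using continuous_field_slice_cong[of I "dx f" "dx g"] assms dx_slice_cong[of f _ g]
  by (simp add: has_cont_dx_def)

lemma dx_scaled:
  assumes "x_differentiable f t"
  shows "dx (\<lambda>t x y. c * f t x y) t = (\<lambda>t x y. c * dx f t x y) t"
  by (intro ext dx_eqI) (auto intro!: derivative_eq_intros x_differentiable_imp_DERIV assms)

lemma has_cont_dx_scaled:
  assumes "has_cont_dx I f"
  shows "has_cont_dx I (\<lambda>t x y. c * f t x y)"
proof -
  have "continuous_field I (\<lambda>t x y. c * dx f t x y)"
    using assms
    by (auto simp: has_cont_dx_def continuous_field_def case_prod_beta intro!: continuous_intros)
  then have "continuous_field I (dx (\<lambda>t x y. c * f t x y))"
    by (subst continuous_field_slice_cong[where g = "\<lambda>t x y. c * dx f t x y"])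
      (simp_all add: dx_scaled has_cont_dx_imp_x_differentiable[OF assms])
  then show ?thesis
    using assms by (auto simp: has_cont_dx_def intro!: derivative_intros)
qed

lemma has_cont_dx_dx_scaled:
  assumes "has_cont_dx I f" "has_cont_dx I (dx f)"
  shows "has_cont_dx I (dx (\<lambda>t x y. c * f t x y))"
proof (subst has_cont_dx_slice_cong)
  show "dx (\<lambda>t x y. c * f t x y) t = (\<lambda>t x y. c * dx f t x y) t" if "t \<in> I" for t
    by (rule dx_scaled[OF has_cont_dx_imp_x_differentiable[OF assms(1) that]])
  show "has_cont_dx I (\<lambda>t x y. c * dx f t x y)"
    by (rule has_cont_dx_scaled[OF assms(2)])
qed

lemma has_cont_dx_dx_dx_scaled:
  assumes "has_cont_dx I f" "has_cont_dx I (dx f)" "has_cont_dx I (dx (dx f))"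
  shows "has_cont_dx I (dx (dx (\<lambda>t x y. c * f t x y)))"
proof (subst has_cont_dx_slice_cong)
  show "dx (dx (\<lambda>t x y. c * f t x y)) t = dx (\<lambda>t x y. c * dx f t x y) t" if "t \<in> I" for t
    by (rule dx_slice_cong, rule dx_scaled[OF has_cont_dx_imp_x_differentiable[OF assms(1) that]])
  show "has_cont_dx I (dx (\<lambda>t x y. c * dx f t x y))"
    by (rule has_cont_dx_dx_scaled[OF assms(2,3)])
qed

text \<open>
  The wave has \<open>v\<^sub>t = - c v\<^sub>x\<close>, so the clauses on \<open>v\<^sub>t\<close>, \<open>v\<^sub>t\<^sub>x\<close>, \<open>v\<^sub>t\<^sub>x\<^sub>x\<close>, \<open>v\<^sub>t\<^sub>x\<^sub>x\<^sub>x\<close> are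
  covered by the four \<open>x\<close>-derivatives that \<open>u\<close> has. Its equation at \<open>(t, x, y)\<close> is the equation for
  \<open>u\<close> at \<open>(0, x - c t, y)\<close> with \<open>L u\<^sub>t\<close> replaced by \<open>- c L u\<^sub>x\<close>.
\<close>

lemma classical_solution_travelling:
  assumes T: "T > 0"
    and sol: "CHKP_classical_solution \<kappa> {0..T} u"
    and defect: "\<And>x y. L_op (dt {0..T} u) 0 x y = - c * L_op (dx u) 0 x y"
  shows "CHKP_classical_solution \<kappa> {0..T} (travelling c u)"
proof -
  let ?I = "{0..T}"
  let ?v = "travelling c u"
  let ?w = "\<lambda>t x y. - c * dx u t x y"
  have 0: "0 \<in> ?I" using T by simp
  have ux: "has_cont_dx ?I u" "has_cont_dx ?I (dx u)" "has_cont_dx ?I (dx (dx u))"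
      "has_cont_dx ?I (dx (dx (dx u)))"
    and uy: "has_cont_dy ?I u" "has_cont_dy ?I (dy u)"
    using sol unfolding CHKP_classical_solution_def by blast+
  note d = classical_solutionD[OF sol 0]
  have deriv: "((\<lambda>s. ?v s x y) has_vector_derivative travelling c ?w t x y) (at t within ?I)"
    for t x y
    using has_vector_derivative_travelling[OF d(3)] by (simp add: travelling_def)
  have dt: "dt ?I ?v t = travelling c ?w t" if "t \<in> ?I" for t
    unfolding dt_def
    by (intro ext vector_derivative_within_closed_interval[OF T that] deriv)
  have dt_x: "dx (dt ?I ?v) t = dx (travelling c ?w) t" if "t \<in> ?I" for t
    using dt[OF that] by (rule dx_slice_cong)
  have dt_xx: "dx (dx (dt ?I ?v)) t = dx (dx (travelling c ?w)) t" if "t \<in> ?I" for t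
    using dt_x[OF that] by (rule dx_slice_cong)
  have "continuous_field ?I ?w"
    using ux(1)
    by (auto simp: has_cont_dx_def continuous_field_def case_prod_beta intro!: continuous_intros)
  then have "continuous_field ?I (dt ?I ?v)"
    by (subst continuous_field_slice_cong[OF dt]) (simp_all only: continuous_field_travelling[OF _ 0])
  then have "has_cont_dt ?I ?v"
    using differentiableI_vector[OF deriv] by (simp add: has_cont_dt_def)
  moreover have "has_cont_dx ?I (dt ?I ?v)"
    by (subst has_cont_dx_slice_cong[OF dt], assumption)
      (intro has_cont_dx_travelling[OF _ 0] has_cont_dx_scaled ux)
  moreover have "has_cont_dx ?I (dx (dt ?I ?v))"
    by (subst has_cont_dx_slice_cong[OF dt_x], assumption, subst dx_travelling)
      (intro has_cont_dx_travelling[OF _ 0] has_cont_dx_dx_scaled ux)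
  moreover have "has_cont_dx ?I (dx (dx (dt ?I ?v)))"
    by (subst has_cont_dx_slice_cong[OF dt_xx], assumption, subst dx_travelling, subst dx_travelling)
      (intro has_cont_dx_travelling[OF _ 0] has_cont_dx_dx_dx_scaled ux)
  moreover have "L_op (dt ?I ?v) t x y + \<kappa> * dx (dx ?v) t x y + dx (CHKP_flux ?v) t x y
      + dy (dy ?v) t x y = 0" if t: "t \<in> ?I" for t x y
  proof -
    have "L_op (dt ?I ?v) t x y = L_op ?w 0 (x - c * t) y"
      unfolding L_op_slice_cong[where f = "dt ?I ?v" and g = "travelling c ?w", OF dt[OF t]]
        L_op_travelling by (simp only: travelling_def)
    also have "\<dots> = L_op (dt ?I u) 0 (x - c * t) y"
      by (simp only: L_op_scaled[OF d(2)] defect)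
    finally have "L_op (dt ?I ?v) t x y = L_op (dt ?I u) 0 (x - c * t) y" .
    moreover have "L_op (dt ?I u) 0 (x - c * t) y + \<kappa> * dx (dx u) 0 (x - c * t) y
        + dx (CHKP_flux u) 0 (x - c * t) y + dy (dy u) 0 (x - c * t) y = 0"
      using sol 0 unfolding CHKP_classical_solution_def CHKP_flux_def by blast
    ultimately show ?thesis
      by (simp add: CHKP_flux_travelling dx_travelling dy_travelling) (simp add: travelling_def)
  qed
  moreover have "has_cont_dx ?I ?v" "has_cont_dx ?I (dx ?v)" "has_cont_dx ?I (dx (dx ?v))"
      "has_cont_dx ?I (dx (dx (dx ?v)))" "has_cont_dy ?I ?v" "has_cont_dy ?I (dy ?v)"
    using has_cont_dx_travelling[OF _ 0] has_cont_dy_travelling[OF _ 0] ux uy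
    by (simp_all only: dx_travelling dy_travelling)
  ultimately show ?thesis
    unfolding CHKP_classical_solution_def CHKP_flux_def by blast
qed

theorem theorem1:
  fixes T \<kappa> :: real
    and u0 :: "real \<Rightarrow> real \<Rightarrow> real"
    and u :: "real \<Rightarrow> real \<Rightarrow> real \<Rightarrow> real"
    and lam :: "real \<Rightarrow> real"
  assumes "T > 0"
    and "CHKP_unique_classical_solution \<kappa> {0..T} u0 u"
    and "x_symmetric_with_axis {0..T} u lam"
  shows "steady_in_x {0..T} u (deriv lam 0)"
proof -
  let ?v = "travelling (deriv lam 0) u"
  have sol: "CHKP_classical_solution \<kappa> {0..T} u"
    using assms(2) by (simp add: CHKP_unique_classical_solution_def)
  have "CHKP_classical_solution \<kappa> {0..T} ?v"
    using L_op_dt_eq_neg_speed_L_op_dx[OF assms(1) _ sol assms(3), of 0] assms(1)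
    by (intro classical_solution_travelling[OF assms(1) sol]) simp
  moreover have "?v 0 x y = u0 x y" for x y
    using assms(2) by (simp add: travelling_def CHKP_unique_classical_solution_def)
  ultimately have "u t x y = ?v t x y" if "t \<in> {0..T}" for t x y
    using assms(2) that unfolding CHKP_unique_classical_solution_def by metis
  then show ?thesis
    unfolding steady_in_x_def travelling_def by blast
qed

end
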